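(* Let $l$ be either $\mathbf{D}$ or $\mathbf{T}$. A modal formula $\varphi$ that is satisfiable for $l$ is complete for $l$ if and only if $P(\varphi)=\emptyset$, i.e. if and only if no propositional variable appears in $\varphi$.
   Context: Modal formulas are generated by $\varphi ::= \bot \mid \top \mid p \mid \neg p \mid \varphi\wedge\varphi \mid \varphi\vee\varphi \mid \Box\varphi \mid \Diamond\varphi$, with $p$ ranging over a countably infinite set of propositional variables. Negation of arbitrary formulas and $\rightarrow$ are defined as usual. $P(\varphi)$ is the set of propositional variables appearing in $\varphi$, and $L(P)$ is the set of formulas using only variables from $P$. $\mathbf{D}$ is the smallest normal modal logic $\mathbf{K}$ plus the axiom $\Diamond\top$; $\mathbf{T}$ is $\mathbf{K}$ plus the axiom $\Box\varphi\rightarrow\varphi$. Models for $\mathbf{D}$ (resp. $\mathbf{T}$) are the finite Kripke models with serial (resp. reflexive) accessibility relation; $\vdash_l\varphi$ (derivability) is equivalent to validity in all models for $l$, and $\varphi$ is satisfiable for $l$ if it is true at some state of some model for $l$. A formula $\varphi$ is complete for $l$ if for every $\psi\in L(P(\varphi))$, $\vdash_l\varphi\rightarrow\psi$ or $\vdash_l\varphi\rightarrow\neg\psi$. *)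

theory Defs
  imports Main
begin

text \<open>Propositional variables are natural numbers.  Formulas are in negation normal form:
  \<open>Neg\<close> applies to variables only, and negation of arbitrary formulas is the dual \<open>neg\<close>.\<close>

type_synonym var = nat

datatype fm =
    Bot
  | Top
  | Var var
  | Neg var
  | And fm fm
  | Or fm fm
  | Box fm
  | Dia fm

primrec vars :: "fm \<Rightarrow> var set" where
  "vars Bot = {}"
| "vars Top = {}"
| "vars (Var p) = {p}"
| "vars (Neg p) = {p}"
| "vars (And \<phi> \<psi>) = vars \<phi> \<union> vars \<psi>"
| "vars (Or \<phi> \<psi>) = vars \<phi> \<union> vars \<psi>"
| "vars (Box \<phi>) = vars \<phi>"
| "vars (Dia \<phi>) = vars \<phi>"

definition language :: "var set \<Rightarrow> fm set" where
  "language P = {\<psi>. vars \<psi> \<subseteq> P}"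

primrec neg :: "fm \<Rightarrow> fm" where
  "neg Bot = Top"
| "neg Top = Bot"
| "neg (Var p) = Neg p"
| "neg (Neg p) = Var p"
| "neg (And \<phi> \<psi>) = Or (neg \<phi>) (neg \<psi>)"
| "neg (Or \<phi> \<psi>) = And (neg \<phi>) (neg \<psi>)"
| "neg (Box \<phi>) = Dia (neg \<phi>)"
| "neg (Dia \<phi>) = Box (neg \<phi>)"

definition Imp :: "fm \<Rightarrow> fm \<Rightarrow> fm" where
  "Imp \<phi> \<psi> = Or (neg \<phi>) \<psi>"

lemma neg_neg [simp]: "neg (neg \<phi>) = \<phi>"
  by (induction \<phi>) simp_all

text \<open>Modal tautologies, i.e. substitution instances of propositional tautologies.
  Boxed formulas are treated as atoms, with truth values given by \<open>b\<close>; as \<open>Dia \<phi>\<close> is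
  the negation of \<open>Box (neg \<phi>)\<close>, its value is determined by that of the latter.\<close>

primrec prop_eval :: "(var \<Rightarrow> bool) \<Rightarrow> (fm \<Rightarrow> bool) \<Rightarrow> fm \<Rightarrow> bool" where
  "prop_eval a b Bot = False"
| "prop_eval a b Top = True"
| "prop_eval a b (Var p) = a p"
| "prop_eval a b (Neg p) = (\<not> a p)"
| "prop_eval a b (And \<phi> \<psi>) = (prop_eval a b \<phi> \<and> prop_eval a b \<psi>)"
| "prop_eval a b (Or \<phi> \<psi>) = (prop_eval a b \<phi> \<or> prop_eval a b \<psi>)"
| "prop_eval a b (Box \<phi>) = b \<phi>"
| "prop_eval a b (Dia \<phi>) = (\<not> b (neg \<phi>))"

lemma prop_eval_neg [simp]: "prop_eval a b (neg \<phi>) \<longleftrightarrow> \<not> prop_eval a b \<phi>"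
  by (induction \<phi>) simp_all

definition tautology :: "fm \<Rightarrow> bool" where
  "tautology \<phi> \<longleftrightarrow> (\<forall>a b. prop_eval a b \<phi>)"

datatype modal_logic = LogicD | LogicT

fun axioms_of :: "modal_logic \<Rightarrow> fm set" where
  "axioms_of LogicD = {Dia Top}"
| "axioms_of LogicT = {Imp (Box \<phi>) \<phi> | \<phi>. True}"

text \<open>The smallest normal modal logic containing the axioms of \<open>l\<close>.  All axioms are
  schematic, so closure under uniform substitution need not be imposed; the duality of
  \<open>Box\<close> and \<open>Dia\<close> is built into \<open>neg\<close>.\<close>

inductive derivable :: "modal_logic \<Rightarrow> fm \<Rightarrow> bool" for l where
  Taut: "tautology \<phi> \<Longrightarrow> derivable l \<phi>"
| K: "derivable l (Imp (Box (Imp \<phi> \<psi>)) (Imp (Box \<phi>) (Box \<psi>)))"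
| Ax: "\<phi> \<in> axioms_of l \<Longrightarrow> derivable l \<phi>"
| MP: "derivable l (Imp \<phi> \<psi>) \<Longrightarrow> derivable l \<phi> \<Longrightarrow> derivable l \<psi>"
| Nec: "derivable l \<phi> \<Longrightarrow> derivable l (Box \<phi>)"

record 'w kripke =
  states :: "'w set"
  acc :: "('w \<times> 'w) set"
  val :: "'w \<Rightarrow> var set"

primrec holds :: "'w kripke \<Rightarrow> 'w \<Rightarrow> fm \<Rightarrow> bool" where
  "holds M w Bot = False"
| "holds M w Top = True"
| "holds M w (Var p) = (p \<in> val M w)"
| "holds M w (Neg p) = (p \<notin> val M w)"
| "holds M w (And \<phi> \<psi>) = (holds M w \<phi> \<and> holds M w \<psi>)"
| "holds M w (Or \<phi> \<psi>) = (holds M w \<phi> \<or> holds M w \<psi>)"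
| "holds M w (Box \<phi>) = (\<forall>v. (w, v) \<in> acc M \<longrightarrow> holds M v \<phi>)"
| "holds M w (Dia \<phi>) = (\<exists>v. (w, v) \<in> acc M \<and> holds M v \<phi>)"

definition finite_kripke :: "'w kripke \<Rightarrow> bool" where
  "finite_kripke M \<longleftrightarrow>
     finite (states M) \<and> states M \<noteq> {} \<and> acc M \<subseteq> states M \<times> states M"

fun frame_condition :: "modal_logic \<Rightarrow> 'w kripke \<Rightarrow> bool" where
  "frame_condition LogicD M \<longleftrightarrow> (\<forall>w \<in> states M. \<exists>v \<in> states M. (w, v) \<in> acc M)"
| "frame_condition LogicT M \<longleftrightarrow> refl_on (states M) (acc M)"

definition model_for :: "modal_logic \<Rightarrow> 'w kripke \<Rightarrow> bool" where
  "model_for l M \<longleftrightarrow> finite_kripke M \<and> frame_condition l M"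

text \<open>Since models are finite, natural numbers suffice as states; see
  \<open>satisfiableI\<close> below.\<close>

definition satisfiable :: "modal_logic \<Rightarrow> fm \<Rightarrow> bool" where
  "satisfiable l \<phi> \<longleftrightarrow>
     (\<exists>(M :: nat kripke) w. model_for l M \<and> w \<in> states M \<and> holds M w \<phi>)"

definition complete_for :: "modal_logic \<Rightarrow> fm \<Rightarrow> bool" where
  "complete_for l \<phi> \<longleftrightarrow>
     (\<forall>\<psi> \<in> language (vars \<phi>). derivable l (Imp \<phi> \<psi>) \<or> derivable l (Imp \<phi> (neg \<psi>)))"

lemma satisfiableI:
  fixes M :: "'w kripke"
  assumes M: "model_for l M" and w: "w \<in> states M" and sat: "holds M w \<phi>"
  shows "satisfiable l \<phi>"
proof -
  have fin: "finite (states M)" and sub: "acc M \<subseteq> states M \<times> states M"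
    using M by (auto simp: model_for_def finite_kripke_def)
  obtain f :: "'w \<Rightarrow> nat" where inj: "inj_on f (states M)"
    using finite_imp_inj_to_nat_seg[OF fin] by blast
  define N :: "nat kripke" where
    "N = \<lparr>states = f ` states M, acc = map_prod f f ` acc M,
          val = (\<lambda>n. val M (inv_into (states M) f n))\<rparr>"
  have acc: "(f x, n) \<in> acc N \<longleftrightarrow> (\<exists>y. n = f y \<and> (x, y) \<in> acc M)" if "x \<in> states M" for x n
    using that sub inj_onD[OF inj] unfolding N_def by fastforce
  have holds: "holds N (f x) \<psi> \<longleftrightarrow> holds M x \<psi>" if "x \<in> states M" for x \<psi>
    using that
  proof (induction \<psi> arbitrary: x)
    case (Box \<psi>)
    have "\<And>y. (x, y) \<in> acc M \<Longrightarrow> y \<in> states M" using sub by auto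
    then show ?case using Box by (auto simp: acc)
  next
    case (Dia \<psi>)
    have "\<And>y. (x, y) \<in> acc M \<Longrightarrow> y \<in> states M" using sub by auto
    then show ?case using Dia by (auto simp: acc)
  qed (auto simp: N_def inv_into_f_f[OF inj])
  have "finite_kripke N"
    using fin w sub by (auto simp: finite_kripke_def N_def)
  moreover have "frame_condition l N"
    using M by (cases l) (fastforce simp: N_def model_for_def refl_on_def)+
  ultimately have "model_for l N" by (simp add: model_for_def)
  moreover have "f w \<in> states N" using w by (simp add: N_def)
  ultimately show ?thesis
    using holds[OF w] sat unfolding satisfiable_def by blast
qed

end

theory Submission
  imports Defs
begin

text \<open>A variable-free formula is provable or refutable, by induction: since \<open>Dia Top\<close> is a
  theorem, a refutable \<open>\<psi>\<close> has a refutable \<open>Box \<psi>\<close>.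

  Conversely, let \<open>\<phi>\<close> contain \<open>p\<close> and hold at \<open>w\<close> in a finite model \<open>M\<close>. Let \<open>B k\<close> say that
  \<open>p\<close> holds at all states reachable in at most \<open>k\<close> steps. As \<open>M\<close> is finite, \<open>B n\<close> implies
  \<open>B (Suc n)\<close> throughout \<open>M\<close> for some \<open>n\<close>. Unravelling \<open>M\<close> to the modal depth of \<open>\<phi>\<close> and
  attaching to the leaves a chain whose first \<open>\<not> p\<close> is at distance \<open>Suc n\<close> preserves \<open>\<phi>\<close> but
  makes that implication fail at a state within reach of \<open>w\<close>. Soundness then shows that \<open>\<phi>\<close>
  decides neither the corresponding boxed implication nor its negation.\<close>

lemma holds_neg [simp]: "holds M w (neg \<phi>) \<longleftrightarrow> \<not> holds M w \<phi>"
  by (induction \<phi> arbitrary: w) auto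

lemma holds_Imp [simp]: "holds M w (Imp \<phi> \<psi>) \<longleftrightarrow> (holds M w \<phi> \<longrightarrow> holds M w \<psi>)"
  by (auto simp: Imp_def)

lemma prop_eval_Imp [simp]:
  "prop_eval a b (Imp \<phi> \<psi>) \<longleftrightarrow> (prop_eval a b \<phi> \<longrightarrow> prop_eval a b \<psi>)"
  by (auto simp: Imp_def)

lemma vars_neg [simp]: "vars (neg \<phi>) = vars \<phi>"
  by (induction \<phi>) auto

lemma vars_Imp [simp]: "vars (Imp \<phi> \<psi>) = vars \<phi> \<union> vars \<psi>"
  by (simp add: Imp_def)

section \<open>Soundness\<close>

text \<open>Reading each boxed formula as an atom whose value is its truth at \<open>w\<close> turns
  a state into a propositional valuation, so tautologies hold at every state.\<close>

lemma prop_eval_holds: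
  "prop_eval (\<lambda>p. p \<in> val M w) (\<lambda>\<psi>. holds M w (Box \<psi>)) \<phi> \<longleftrightarrow> holds M w \<phi>"
  by (induction \<phi>) auto

lemma soundness:
  assumes "derivable l \<phi>" and "model_for l M" and "w \<in> states M"
  shows "holds M w \<phi>"
  using assms(1,3)
proof (induction arbitrary: w)
  case (Taut \<phi>)
  then show ?case using prop_eval_holds[of M w \<phi>] by (simp add: tautology_def)
next
  case (Ax \<phi>)
  then show ?case using assms(2)
    by (cases l) (auto simp: model_for_def refl_on_def)
next
  case (Nec \<phi>)
  then show ?case using assms(2) by (auto simp: model_for_def finite_kripke_def)
qed auto

lemma not_complete_forI:
  assumes "\<psi> \<in> language (vars \<phi>)"
    and "model_for l M" "w \<in> states M" "holds M w \<phi>" "holds M w \<psi>"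
    and "model_for l N" "v \<in> states N" "holds N v \<phi>" "\<not> holds N v \<psi>"
  shows "\<not> complete_for l \<phi>"
proof
  assume "complete_for l \<phi>"
  then consider "derivable l (Imp \<phi> \<psi>)" | "derivable l (Imp \<phi> (neg \<psi>))"
    using assms(1) unfolding complete_for_def by blast
  then show False
  proof cases
    case 1
    then show False using soundness[OF 1 assms(6,7)] assms(8,9) by simp
  next
    case 2
    then show False using soundness[OF 2 assms(2,3)] assms(4,5) by simp
  qed
qed

section \<open>Variable-free formulas\<close>

lemma derivable_consequence:
  assumes "derivable l \<phi>" and "\<And>a b. prop_eval a b \<phi> \<Longrightarrow> prop_eval a b \<psi>"
  shows "derivable l \<psi>"
  using derivable.MP[OF derivable.Taut assms(1)] assms(2) by (simp add: tautology_def)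

lemma derivable_And:
  assumes "derivable l \<phi>" and "derivable l \<psi>"
  shows "derivable l (And \<phi> \<psi>)"
proof -
  have "derivable l (Imp \<psi> (And \<phi> \<psi>))"
    using assms(1) by (rule derivable_consequence) simp
  then show ?thesis using assms(2) by (rule derivable.MP)
qed

lemma derivable_Dia_Top: "derivable l (Dia Top)"
proof (cases l)
  case LogicD
  then show ?thesis by (intro derivable.Ax) simp
next
  case LogicT
  \<comment> \<open>\<open>Dia Top\<close> is propositionally the negation of
    \<open>Box (neg Top)\<close>, and \<open>neg Top\<close> is \<open>Bot\<close>.\<close>
  then have "derivable l (Imp (Box Bot) Bot)" by (intro derivable.Ax) auto
  then show ?thesis by (rule derivable_consequence) simp
qed

lemma derivable_Dia:
  assumes "derivable l \<psi>"
  shows "derivable l (Dia \<psi>)"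
proof -
  have "derivable l (Imp (neg \<psi>) Bot)"
    using assms by (rule derivable_consequence) simp
  then have "derivable l (Imp (Box (neg \<psi>)) (Box Bot))"
    by (blast intro: derivable.Nec derivable.K derivable.MP)
  then have "derivable l (And (Imp (Box (neg \<psi>)) (Box Bot)) (Dia Top))"
    using derivable_Dia_Top by (rule derivable_And)
  then show ?thesis by (rule derivable_consequence) auto
qed

lemma variable_free_decided:
  assumes "vars \<psi> = {}"
  shows "derivable l \<psi> \<or> derivable l (neg \<psi>)"
  using assms
proof (induction \<psi>)
  case Bot
  then show ?case by (simp add: derivable.Taut tautology_def)
next
  case Top
  then show ?case by (simp add: derivable.Taut tautology_def)
next
  case (And \<psi> \<chi>)
  then show ?case
    using derivable_And[of l \<psi> \<chi>]
      derivable_consequence[of l "neg \<psi>" "neg (And \<psi> \<chi>)"]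
      derivable_consequence[of l "neg \<chi>" "neg (And \<psi> \<chi>)"] by auto
next
  case (Or \<psi> \<chi>)
  then show ?case
    using derivable_And[of l "neg \<psi>" "neg \<chi>"]
      derivable_consequence[of l \<psi> "Or \<psi> \<chi>"]
      derivable_consequence[of l \<chi> "Or \<psi> \<chi>"] by auto
qed (auto intro: derivable.Nec derivable_Dia)

lemma variable_free_complete:
  assumes "vars \<phi> = {}"
  shows "complete_for l \<phi>"
  unfolding complete_for_def
proof
  fix \<psi> assume "\<psi> \<in> language (vars \<phi>)"
  then have "vars \<psi> = {}" using assms by (simp add: language_def)
  then show "derivable l (Imp \<phi> \<psi>) \<or> derivable l (Imp \<phi> (neg \<psi>))"
    using variable_free_decided[of \<psi> l]
      derivable_consequence[of l \<psi> "Imp \<phi> \<psi>"]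
      derivable_consequence[of l "neg \<psi>" "Imp \<phi> (neg \<psi>)"] by auto
qed

section \<open>Formulas with variables\<close>

primrec depth :: "fm \<Rightarrow> nat" where
  "depth Bot = 0"
| "depth Top = 0"
| "depth (Var p) = 0"
| "depth (Neg p) = 0"
| "depth (And \<phi> \<psi>) = max (depth \<phi>) (depth \<psi>)"
| "depth (Or \<phi> \<psi>) = max (depth \<phi>) (depth \<psi>)"
| "depth (Box \<phi>) = Suc (depth \<phi>)"
| "depth (Dia \<phi>) = Suc (depth \<phi>)"

primrec within :: "var \<Rightarrow> nat \<Rightarrow> fm" where
  "within p 0 = Var p"
| "within p (Suc k) = And (Var p) (Box (within p k))"

lemma vars_within [simp]: "vars (within p k) = {p}"
  by (induction k) auto

lemma vars_Box_power [simp]: "vars ((Box ^^ k) \<phi>) = vars \<phi>"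
  by (induction k) auto

lemma within_antimono: "holds M x (within p (Suc k)) \<Longrightarrow> holds M x (within p k)"
  by (induction k arbitrary: x) auto

lemma within_stabilizes:
  assumes "finite (states M)"
  obtains n where "\<And>x. x \<in> states M \<Longrightarrow> holds M x (Imp (within p n) (within p (Suc n)))"
proof -
  define X where "X k = {x \<in> states M. holds M x (within p k)}" for k
  \<comment> \<open>The sets \<open>X k\<close> shrink as \<open>k\<close> grows, so they stop
    shrinking where the cardinality is least.\<close>
  obtain n where n: "\<And>k. card (X n) \<le> card (X k)"
    using ex_has_least_nat[of "\<lambda>_. True" 0 "\<lambda>k. card (X k)"] by blast
  have "finite (X n)" "X (Suc n) \<subseteq> X n"
    using assms within_antimono unfolding X_def by (auto simp del: within.simps)
  then have "X (Suc n) = X n" using n by (intro card_seteq)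
  then show ?thesis using that unfolding X_def by (auto simp del: within.simps)
qed

lemma holds_Box_power:
  assumes "\<And>x. x \<in> states M \<Longrightarrow> holds M x \<psi>" "acc M \<subseteq> states M \<times> states M" "x \<in> states M"
  shows "holds M x ((Box ^^ k) \<psi>)"
  using assms(3)
proof (induction k arbitrary: x)
  case (Suc k)
  then show ?case using assms(2) by auto
qed (simp add: assms(1))

text \<open>The number in \<open>Inl (x, k)\<close> counts the steps left before the chain can be entered, at
  \<open>Inr m\<close>; the chain is traversed downwards. Edges within a layer keep a reflexive
  relation reflexive, and do no harm for serial ones.\<close>

inductive_set attach_acc :: "'w kripke \<Rightarrow> nat \<Rightarrow> nat \<Rightarrow> (('w \<times> nat + nat) \<times> ('w \<times> nat + nat)) set"
  for M d m where
  stay: "(x, y) \<in> acc M \<Longrightarrow> k \<le> d \<Longrightarrow> (Inl (x, k), Inl (y, k)) \<in> attach_acc M d m"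
| down: "(x, y) \<in> acc M \<Longrightarrow> k < d \<Longrightarrow> (Inl (x, Suc k), Inl (y, k)) \<in> attach_acc M d m"
| enter: "x \<in> states M \<Longrightarrow> (Inl (x, 0), Inr m) \<in> attach_acc M d m"
| chain_stay: "j \<le> m \<Longrightarrow> (Inr j, Inr j) \<in> attach_acc M d m"
| chain_down: "j < m \<Longrightarrow> (Inr (Suc j), Inr j) \<in> attach_acc M d m"

definition attach :: "'w kripke \<Rightarrow> nat \<Rightarrow> nat \<Rightarrow> ('w \<times> nat + nat) kripke" where
  "attach M d m = \<lparr>states = Inl ` (states M \<times> {..d}) \<union> Inr ` {..m}, acc = attach_acc M d m,
     val = (\<lambda>s. case s of Inl (x, k) \<Rightarrow> val M x | Inr j \<Rightarrow> if j = 0 then {} else UNIV)\<rparr>"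

lemma attach_simps [simp]:
  "Inl (x, k) \<in> states (attach M d m) \<longleftrightarrow> x \<in> states M \<and> k \<le> d"
  "Inr j \<in> states (attach M d m) \<longleftrightarrow> j \<le> m"
  "val (attach M d m) (Inl (x, k)) = val M x"
  "val (attach M d m) (Inr j) = (if j = 0 then {} else UNIV)"
  "acc (attach M d m) = attach_acc M d m"
  by (auto simp: attach_def)

lemma model_for_successor:
  assumes "model_for l M" "x \<in> states M"
  obtains y where "y \<in> states M" "(x, y) \<in> acc M"
  using assms by (cases l) (auto simp: model_for_def refl_on_def)

lemma model_for_attach:
  assumes "model_for l M"
  shows "model_for l (attach M d m)"
proof -
  have fin: "finite (states M)" and sub: "acc M \<subseteq> states M \<times> states M"
    using assms by (auto simp: model_for_def finite_kripke_def)
  have "s \<in> states (attach M d m) \<and> t \<in> states (attach M d m)"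
    if "(s, t) \<in> attach_acc M d m" for s t
    using that by cases (use sub in auto)
  then have "finite_kripke (attach M d m)"
    using fin by (auto simp: finite_kripke_def) (auto simp: attach_def)
  moreover have "frame_condition l (attach M d m)"
  proof (cases l)
    case LogicD
    have "\<exists>t \<in> states (attach M d m). (s, t) \<in> attach_acc M d m"
      if s: "s \<in> states (attach M d m)" for s
    proof (cases s)
      case (Inl a)
      then obtain x k where x: "s = Inl (x, k)" "x \<in> states M" "k \<le> d"
        using s by (cases a) auto
      then obtain y where "y \<in> states M" "(x, y) \<in> acc M"
        using model_for_successor[OF assms] by auto
      then show ?thesis using x by (intro bexI[of _ "Inl (y, k)"]) (auto intro: attach_acc.stay)
    next
      case (Inr j)
      then show ?thesis using s by (intro bexI[of _ s]) (auto intro: attach_acc.chain_stay)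
    qed
    then show ?thesis using LogicD by simp
  next
    case LogicT
    have "(s, s) \<in> attach_acc M d m" if "s \<in> states (attach M d m)" for s
      using that assms LogicT
      by (cases s) (auto simp: model_for_def refl_on_def intro: attach_acc.stay attach_acc.chain_stay)
    then show ?thesis using LogicT by (simp add: refl_on_def)
  qed
  ultimately show ?thesis by (simp add: model_for_def)
qed

lemma attach_acc_Inl_Suc:
  assumes "Suc i \<le> d"
  shows "(Inl (x, Suc i), t) \<in> attach_acc M d m \<longleftrightarrow>
    (\<exists>y. (x, y) \<in> acc M \<and> (t = Inl (y, Suc i) \<or> t = Inl (y, i)))"
  using assms by (auto elim: attach_acc.cases intro: attach_acc.stay attach_acc.down)

text \<open>Each modality lowers the layer by at most one, and the chain is visible only from layer
  0. From a higher layer the successors are copies of those in \<open>M\<close>, so a formula of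
  depth at most \<open>k\<close> cannot detect the chain.\<close>

lemma holds_attach_Inl:
  assumes "depth \<chi> \<le> k" "k \<le> d"
  shows "holds (attach M d m) (Inl (x, k)) \<chi> \<longleftrightarrow> holds M x \<chi>"
  using assms
proof (induction \<chi> arbitrary: x k)
  case (Box \<chi>)
  then obtain i where "k = Suc i" "depth \<chi> \<le> i" "Suc i \<le> d" by (cases k) auto
  then show ?case
    using Box.IH[of i] Box.IH[of "Suc i"] by (auto simp: attach_acc_Inl_Suc)
next
  case (Dia \<chi>)
  then obtain i where "k = Suc i" "depth \<chi> \<le> i" "Suc i \<le> d" by (cases k) auto
  then show ?case
    using Dia.IH[of i] Dia.IH[of "Suc i"] by (auto simp: attach_acc_Inl_Suc)
qed auto

text \<open>Only \<open>Inr 0\<close> falsifies \<open>p\<close>, and it lies exactly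
  \<open>j\<close> steps from \<open>Inr j\<close>; the loops do not shorten this distance.\<close>

lemma holds_attach_within:
  assumes "j \<le> m"
  shows "holds (attach M d m) (Inr j) (within p k) \<longleftrightarrow> k < j"
  using assms
proof (induction k arbitrary: j)
  case (Suc k)
  have succ: "(Inr j, t) \<in> attach_acc M d m \<longleftrightarrow> t = Inr j \<or> (j > 0 \<and> t = Inr (j - 1))" for t
    using Suc.prems
    by (cases j) (auto elim: attach_acc.cases intro: attach_acc.chain_stay attach_acc.chain_down)
  show ?case using Suc by (auto simp: succ)
qed simp

text \<open>A path takes \<open>k\<close> steps down to layer 0 and one more to enter the chain,
  which accounts for the \<open>Suc k\<close> boxes. It exists because every state of
  \<open>M\<close> has a successor.\<close>

lemma attach_reaches_chain:
  assumes "model_for l M" "x \<in> states M" "k \<le> d" "\<not> holds (attach M d m) (Inr m) \<psi>"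
  shows "\<not> holds (attach M d m) (Inl (x, k)) ((Box ^^ Suc k) \<psi>)"
  using assms(2,3)
proof (induction k arbitrary: x)
  case 0
  then show ?case using assms(4) attach_acc.enter by fastforce
next
  case (Suc k)
  obtain y where "y \<in> states M" "(x, y) \<in> acc M"
    by (rule model_for_successor[OF assms(1) Suc.prems(1)])
  then have "(Inl (x, Suc k), Inl (y, k)) \<in> acc (attach M d m)"
    and "\<not> holds (attach M d m) (Inl (y, k)) ((Box ^^ Suc k) \<psi>)"
    using Suc.IH[of y] Suc.prems(2) by (auto intro: attach_acc.down simp del: funpow.simps)
  then show ?case by auto
qed

theorem lemma12:
  fixes l :: modal_logic and \<phi> :: fm
  assumes "satisfiable l \<phi>"
  shows "complete_for l \<phi> \<longleftrightarrow> vars \<phi> = {}"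
proof
  assume complete: "complete_for l \<phi>"
  show "vars \<phi> = {}"
  proof (rule ccontr)
    assume "vars \<phi> \<noteq> {}"
    then obtain p where p: "p \<in> vars \<phi>" by blast
    obtain M :: "nat kripke" and w where M: "model_for l M" "w \<in> states M" "holds M w \<phi>"
      using assms unfolding satisfiable_def by blast
    have fin: "finite (states M)" and sub: "acc M \<subseteq> states M \<times> states M"
      using M(1) by (auto simp: model_for_def finite_kripke_def)
    obtain n where
      n: "\<And>x. x \<in> states M \<Longrightarrow> holds M x (Imp (within p n) (within p (Suc n)))"
      using within_stabilizes[OF fin] by blast
    define d where "d = depth \<phi>"
    define \<psi> where "\<psi> = (Box ^^ Suc d) (Imp (within p n) (within p (Suc n)))"
    \<comment> \<open>The entry state \<open>Inr (Suc n)\<close> satisfies \<open>within p n\<close>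
      but not \<open>within p (Suc n)\<close>, so it refutes the implication that holds throughout
      \<open>M\<close>.\<close>
    define N where "N = attach M d (Suc n)"
    have "\<psi> \<in> language (vars \<phi>)"
      using p unfolding \<psi>_def language_def by (simp del: funpow.simps)
    moreover have "holds M w \<psi>"
      unfolding \<psi>_def using n sub M(2) by (rule holds_Box_power)
    moreover have "model_for l N"
      unfolding N_def using M(1) by (rule model_for_attach)
    moreover have "Inl (w, d) \<in> states N"
      using M(2) by (simp add: N_def)
    moreover have "holds N (Inl (w, d)) \<phi>"
      using M(3) by (simp add: N_def d_def holds_attach_Inl)
    moreover have "\<not> holds N (Inl (w, d)) \<psi>"
      unfolding N_def \<psi>_def using M(1,2)
      by (rule attach_reaches_chain) (simp_all add: holds_attach_within del: within.simps)
    ultimately have "\<not> complete_for l \<phi>"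
      using M by (intro not_complete_forI[of \<psi> \<phi> l M w N "Inl (w, d)"])
    then show False using complete by contradiction
  qed
qed (rule variable_free_complete)

end
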